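(* Let $G$ be a finite simple connected graph which is not a complete graph. Then there is a nonedge $uv$ of $G$ such that $\beth^{1}(G/uv)\le \beth^{1}(G)$.
   Context: All graphs are finite and simple. A nonedge $uv$ is a pair of distinct nonadjacent vertices. $G/uv$ denotes the nonedge contraction of $uv$: the simple graph obtained by identifying $u$ and $v$ to a single vertex, adjacent to exactly those other vertices that are adjacent to $u$ or $v$ in $G$ (no loops or multiple edges; equivalently, add the edge $uv$ and contract it). The first graph characteristic is $\beth^{1}(G)=|E(G)|-|V(G)|$. *)

theory Defs
  imports "Graph_Theory.Graph_Theory"
begin

text \<open>
  Finite simple graphs are \<^locale>\<open>pair_graph\<close>s, that is, finite loop-free symmetric
  digraphs whose arcs are pairs of vertices. An undirected edge corresponds to two opposite arcs,
  so edges have to be counted as unordered pairs and not as arcs.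
\<close>

definition edges_of :: "'a pair_pre_digraph \<Rightarrow> 'a set set" where
  "edges_of G = {{x, y} | x y. (x, y) \<in> parcs G}"

definition nonedge :: "'a pair_pre_digraph \<Rightarrow> 'a \<Rightarrow> 'a \<Rightarrow> bool" where
  "nonedge G u v \<longleftrightarrow> u \<in> pverts G \<and> v \<in> pverts G \<and> u \<noteq> v \<and> (u, v) \<notin> parcs G"

text \<open>
  The map \<^term>\<open>id(v := u)\<close> identifies \<open>v\<close> with \<open>u\<close>; the merged vertex is
  represented by \<open>u\<close>. Loops are discarded, and parallel arcs collapse because the arcs
  form a set of pairs.
\<close>

definition contract :: "'a pair_pre_digraph \<Rightarrow> 'a \<Rightarrow> 'a \<Rightarrow> 'a pair_pre_digraph" where
  "contract G u v = (let f = id(v := u) in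
     \<lparr> pverts = f ` pverts G,
       parcs = {(f x, f y) | x y. (x, y) \<in> parcs G \<and> f x \<noteq> f y} \<rparr>)"

definition first_characteristic :: "'a pair_pre_digraph \<Rightarrow> int" where
  "first_characteristic G = int (card (edges_of G)) - int (card (pverts G))"

lemma pverts_contract:
  assumes "nonedge G u v"
  shows "pverts (contract G u v) = pverts G - {v}"
  using assms by (auto simp: contract_def nonedge_def Let_def image_iff)

lemma parcs_contract_iff:
  "(a, b) \<in> parcs (contract G u v) \<longleftrightarrow>
    a \<noteq> b \<and> (\<exists>x y. (x, y) \<in> parcs G \<and>
      (a = x \<and> x \<noteq> v \<or> a = u \<and> x = v) \<and> (b = y \<and> y \<noteq> v \<or> b = u \<and> y = v))"
proof -
  have f: "a = (id(v := u)) x \<longleftrightarrow> a = x \<and> x \<noteq> v \<or> a = u \<and> x = v" for a x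
    by auto
  show ?thesis
    unfolding f[symmetric] contract_def Let_def pair_pre_digraph.simps mem_Collect_eq prod.inject
    by blast
qed

lemma adjacent_contract:
  assumes "nonedge G u v" "x \<in> pverts G - {u, v}" "y \<in> pverts G - {u, v}"
  shows "(u, y) \<in> parcs (contract G u v) \<longleftrightarrow> (u, y) \<in> parcs G \<or> (v, y) \<in> parcs G"
    and "(x, y) \<in> parcs (contract G u v) \<longleftrightarrow> x \<noteq> y \<and> (x, y) \<in> parcs G"
proof -
  have "u \<noteq> v" "x \<noteq> u" "x \<noteq> v" "y \<noteq> u" "y \<noteq> v"
    using assms by (auto simp: nonedge_def)
  then show "(u, y) \<in> parcs (contract G u v) \<longleftrightarrow> (u, y) \<in> parcs G \<or> (v, y) \<in> parcs G"
    and "(x, y) \<in> parcs (contract G u v) \<longleftrightarrow> x \<noteq> y \<and> (x, y) \<in> parcs G"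
    unfolding parcs_contract_iff by blast+
qed

lemma pair_graph_contract:
  assumes "pair_graph G" "nonedge G u v"
  shows "pair_graph (contract G u v)"
proof -
  interpret pair_graph G by fact
  have V: "pverts (contract G u v) = pverts G - {v}" "u \<in> pverts G" "u \<noteq> v"
    using assms(2) by (auto simp: pverts_contract nonedge_def)
  have swap: "(y, x) \<in> parcs G" if "(x, y) \<in> parcs G" for x y
    using pair_sym_arcs that by (auto simp: symmetric_def dest: symD)
  have mem: "a \<in> pverts (contract G u v)" "b \<in> pverts (contract G u v)" "a \<noteq> b"
    if ab: "(a, b) \<in> parcs (contract G u v)" for a b
  proof -
    obtain x y where "(x, y) \<in> parcs G" and ne: "a \<noteq> b"
      and xy: "a = x \<and> x \<noteq> v \<or> a = u \<and> x = v" "b = y \<and> y \<noteq> v \<or> b = u \<and> y = v"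
      using ab unfolding parcs_contract_iff by blast
    then have "x \<in> pverts G" "y \<in> pverts G"
      by (blast dest: in_arcsD1 in_arcsD2)+
    then show "a \<in> pverts (contract G u v)" "b \<in> pverts (contract G u v)"
      using xy V by blast+
    show "a \<noteq> b" by (fact ne)
  qed
  have fin: "finite (pverts (contract G u v))"
    using V(1) pair_finite_verts by simp
  have "sym (parcs (contract G u v))"
    by (rule symI) (use swap in \<open>unfold parcs_contract_iff, blast\<close>)
  then have "symmetric (with_proj (contract G u v))"
    by (simp only: symmetric_def with_proj_simps)
  moreover have "finite (parcs (contract G u v))"
  proof (rule finite_subset)
    show "parcs (contract G u v) \<subseteq> pverts (contract G u v) \<times> pverts (contract G u v)"
      by (rule subrelI) (use mem in blast)
    show "finite (pverts (contract G u v) \<times> pverts (contract G u v))"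
      using fin by (intro finite_cartesian_product)
  qed
  moreover have "fst e \<in> pverts (contract G u v)" "snd e \<in> pverts (contract G u v)" "fst e \<noteq> snd e"
    if "e \<in> parcs (contract G u v)" for e
    using mem that by (metis prod.collapse)+
  ultimately show ?thesis
    using fin by unfold_locales
qed

end

theory Submission
  imports Defs
begin

text \<open>
  Contracting a nonedge removes one vertex and merges the two edges joining its ends to a common
  neighbour, so it suffices to find two nonadjacent vertices with a common neighbour. On a walk from
  \<open>a\<close> to a vertex not adjacent to \<open>a\<close>, the first vertex that leaves the closed
  neighbourhood of \<open>a\<close> is such a partner of \<open>a\<close>.
\<close>

lemma (in pair_graph) parcs_sym:
  "(x, y) \<in> parcs G \<Longrightarrow> (y, x) \<in> parcs G"
  using pair_sym_arcs by (auto simp: symmetric_def dest: symD)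

lemma (in pair_graph) finite_edges_of: "finite (edges_of G)"
proof -
  have "edges_of G = (\<lambda>(x, y). {x, y}) ` parcs G"
    by (auto simp: edges_of_def)
  then show ?thesis
    using pair_finite_arcs by simp
qed

lemma (in pair_graph) nonedge_exists:
  assumes "\<not> (\<exists>n. complete_digraph n (with_proj G))"
  obtains a b where "nonedge G a b"
proof -
  have "\<exists>a b. nonedge G a b"
  proof (rule ccontr)
    assume "\<not> ?thesis"
    then have "parcs G = {(x, y). (x, y) \<in> pverts G \<times> pverts G \<and> x \<noteq> y}"
      by (auto simp: nonedge_def dest: in_arcsD1 in_arcsD2 no_loops')
    moreover have "graph (with_proj G)"
      by unfold_locales
    \<comment> \<open>The parameter of \<open>complete_digraph\<close> is the number of vertices, so
      \<open>card (pverts G)\<close> is the witness that contradicts the assumption.\<close>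
    ultimately have "complete_digraph (card (pverts G)) (with_proj G)"
      by (auto simp: complete_digraph_def arcs_ends_conv)
    with assms show False by blast
  qed
  then show thesis using that by blast
qed

lemma (in pair_graph) nonedge_common_neighbour_exists:
  assumes "connected (with_proj G)" "nonedge G a b"
  obtains w v where "(a, w) \<in> parcs G" "(v, w) \<in> parcs G" "nonedge G a v"
proof -
  \<comment> \<open>Connectedness gives reachability in the symmetric closure, which for the
    symmetric \<open>G\<close> is reachability along its own arcs.\<close>
  have "(a, b) \<in> (parcs G)\<^sup>*"
    using assms reachable_mk_symmetric_eq[OF pair_sym_arcs, of a b]
      reachable_rtranclI[of "with_proj G" a b]
    by (auto simp: connected_def strongly_connected_def nonedge_def)
  \<comment> \<open>If no arc left the closed neighbourhood of \<open>a\<close>, induction along the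
    walk would place \<open>b\<close> in it.\<close>
  have "\<exists>x y. (x, y) \<in> parcs G \<and> (x = a \<or> (a, x) \<in> parcs G) \<and> y \<noteq> a \<and> (a, y) \<notin> parcs G"
  proof (rule ccontr)
    assume closed: "\<not> ?thesis"
    from \<open>(a, b) \<in> (parcs G)\<^sup>*\<close> have "b = a \<or> (a, b) \<in> parcs G"
      by (induction rule: rtrancl_induct) (use closed in blast)+
    with assms(2) show False by (auto simp: nonedge_def)
  qed
  then obtain x y where xy: "(x, y) \<in> parcs G" "x = a \<or> (a, x) \<in> parcs G" "y \<noteq> a" "(a, y) \<notin> parcs G"
    by blast
  show thesis
  proof
    \<comment> \<open>Here \<open>x = a\<close> is impossible, since the arc from \<open>x\<close>
      to \<open>y\<close> would make \<open>y\<close> a neighbour of \<open>a\<close>.\<close>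
    show "(a, x) \<in> parcs G" "(y, x) \<in> parcs G"
      using xy parcs_sym by blast+
    show "nonedge G a y"
      using xy assms(2) by (auto simp: nonedge_def dest: in_arcsD2)
  qed
qed

text \<open>Every edge of the contraction is the image of an edge of \<open>G\<close> under the
  identification map, and this map on edges is not injective: the distinct edges
  \<open>{u, w}\<close> and \<open>{v, w}\<close> have the same image.\<close>

lemma (in pair_graph) card_edges_contract_less:
  assumes uv: "nonedge G u v" and uw: "(u, w) \<in> parcs G" and vw: "(v, w) \<in> parcs G"
  shows "card (edges_of (contract G u v)) < card (edges_of G)"
proof -
  define f where "f = id(v := u)"
  have "w \<noteq> v" "u \<noteq> v"
    using uv vw no_loops' by (auto simp: nonedge_def)
  then have ne: "{u, w} \<noteq> {v, w}" and eq: "f ` {u, w} = f ` {v, w}"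
    by (auto simp: f_def doubleton_eq_iff)
  have mem: "{u, w} \<in> edges_of G" "{v, w} \<in> edges_of G"
    using uw vw by (auto simp: edges_of_def)
  have "edges_of (contract G u v) \<subseteq> (`) f ` edges_of G"
    unfolding edges_of_def contract_def Let_def f_def[symmetric]
    by (auto intro!: image_eqI[of _ _ "{_, _}"])
  then have "card (edges_of (contract G u v)) \<le> card ((`) f ` edges_of G)"
    using finite_edges_of by (intro card_mono) auto
  also have "\<dots> < card (edges_of G)"
  proof -
    have "\<not> inj_on ((`) f) (edges_of G)"
      using ne eq mem by (meson inj_onD)
    then show ?thesis
      using finite_edges_of card_image_le inj_on_iff_eq_card by (metis le_neq_implies_less)
  qed
  finally show ?thesis .
qed

theorem theorem2p2p1:
  fixes G :: "'a pair_pre_digraph"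
  assumes "pair_graph G"
    and "connected (with_proj G)"
    and "\<not> (\<exists>n. complete_digraph n (with_proj G))"
  shows "\<exists>u v. nonedge G u v \<and>
    first_characteristic (contract G u v) \<le> first_characteristic G"
proof -
  interpret pair_graph G by fact
  obtain a b where "nonedge G a b"
    using nonedge_exists assms(3) by blast
  then obtain w v where uw: "(a, w) \<in> parcs G" "(v, w) \<in> parcs G" and ne: "nonedge G a v"
    using nonedge_common_neighbour_exists assms(2) by blast
  \<comment> \<open>Positivity makes the truncated subtraction a genuine loss of one vertex, which
    the loss of at least one edge offsets.\<close>
  have "card (pverts (contract G a v)) = card (pverts G) - 1" "card (pverts G) > 0"
    using ne pair_finite_verts by (auto simp: pverts_contract nonedge_def card_gt_0_iff)
  then have "first_characteristic (contract G a v) \<le> first_characteristic G"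
    using card_edges_contract_less[OF ne uw] by (simp add: first_characteristic_def)
  with ne show ?thesis by blast
qed

end
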